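(* For all positive integers $N$ and $k$ with $k\ge 3$, it holds that $h(N,k)\le h(N+1,k)$.
   Context: A state with $k$ vessels is a vector $A=(a_1,\dots,a_k)$ of non-negative integers (the contents of the vessels). A pouring step chooses two distinct vessels with contents $x$ and $y$, where $x\le y$, and replaces these contents by $2x$ (for the vessel that contained $x$) and $y-x$ (for the vessel that contained $y$); all other contents are unchanged. For an integer $p\ge 0$, a state is $p$-pourable if some sequence of at most $p$ pouring steps leads to a state in which at least one vessel has content $0$. For positive integers $N$ and $k\ge 3$, $h(N,k)$ is the largest positive integer $n$ such that all states $A=(a_1,\dots,a_k)$ with $a_1+\cdots+a_k=n$ are $N$-pourable. *)

theory Defs
  imports Main
begin

inductive pour :: "nat list \<Rightarrow> nat list \<Rightarrow> bool" where
  "i < length A \<Longrightarrow> j < length A \<Longrightarrow> i \<noteq> j \<Longrightarrow> A ! i \<le> A ! j \<Longrightarrow>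
     pour A (A[i := 2 * A ! i, j := A ! j - A ! i])"

definition pourable :: "nat \<Rightarrow> nat list \<Rightarrow> bool" where
  "pourable p A \<longleftrightarrow> (\<exists>q\<le>p. \<exists>B. (pour ^^ q) A B \<and> 0 \<in> set B)"

(* GREATEST carries information only if the maximum exists. For k >= 3 and fixed N
   it does. Every state of sum 1 already has an empty vessel. Each sequence of pouring
   choices acts as an invertible linear map, so N-pourable states lie on finitely many
   hyperplanes through the origin, which cannot cover all states of large sum. *)
definition h :: "nat \<Rightarrow> nat \<Rightarrow> nat" where
  "h N k = (GREATEST n. n > 0 \<and> (\<forall>A. length A = k \<and> sum_list A = n \<longrightarrow> pourable N A))"

end

theory Submission
  imports Defs
begin

text \<open>
  Monotonicity is immediate once both maxima exist, so the point is that for fixed \<open>p\<close> and \<open>k\<close>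
  every large \<open>n\<close> is the sum of a state that is not \<open>p\<close>-pourable. Call a state \<open>R\<close>-separated if
  all contents are positive and any two of them differ by a factor greater than \<open>R\<close>. A pouring
  step changes each content of a \<open>4R\<close>-separated state by a factor of at most 2, so it leads to an
  \<open>R\<close>-separated state; hence a \<open>4^p\<close>-separated state survives \<open>p\<close> steps. Powers of \<open>R + 1\<close>
  together with one very large content form an \<open>R\<close>-separated state of any prescribed large sum.
\<close>

text \<open>Positivity is a clause of its own: a single zero among positive contents would pass all
  the comparisons.\<close>

definition separated :: "nat \<Rightarrow> nat list \<Rightarrow> bool" where
  "separated R A \<longleftrightarrow> 0 \<notin> set A \<and>
     (\<forall>i<length A. \<forall>j<length A. i \<noteq> j \<longrightarrow> R * A ! i < A ! j \<or> R * A ! j < A ! i)"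

lemma separated_pour:
  assumes "pour A B" and sep: "separated (4 * R) A" and "R > 0"
  shows "separated R B"
  using assms(1)
proof cases
  case (1 i j)
  define x y where "x = A ! i" and "y = A ! j"
  have pos: "A ! m > 0" if "m < length A" for m
    using sep that unfolding separated_def by (metis nth_mem not_gr_zero)
  have cmp: "4 * (R * A ! m) < A ! l \<or> 4 * (R * A ! l) < A ! m"
    if "m < length A" "l < length A" "m \<noteq> l" for m l
    using sep that unfolding separated_def by (simp add: mult.assoc)
  have "y \<le> R * y" "x \<le> R * x"
    using \<open>R > 0\<close> by simp_all
  \<comment> \<open>The alternative \<open>4 * (R * y) < x\<close> contradicts
    \<open>x \<le> y\<close>. From \<open>4 * x < y\<close>, the vessel poured from keeps more than
    half of its content.\<close>
  then have xy: "4 * (R * x) < y" "4 * x < y"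
    using cmp[of i j] 1 pos[of j] unfolding x_def y_def by linarith+
  have B: "B ! m = (if m = j then y - x else if m = i then 2 * x else A ! m)"
    if "m < length A" for m
    using 1 that by (auto simp: x_def y_def)
  have len: "length B = length A"
    using 1 by simp
  have le: "B ! m \<le> 2 * A ! m" "A ! m \<le> 2 * B ! m" if "m < length A" for m
    using B[OF that] xy by (auto simp: x_def y_def)
  have posB: "B ! m > 0" if "m < length A" for m
    using le(2)[OF that] pos[OF that] by linarith
  have cmpB: "R * B ! m < B ! l \<or> R * B ! l < B ! m"
    if "m < length A" "l < length A" "m \<noteq> l" for m l
  proof -
    have "R * B ! m \<le> 2 * (R * A ! m)" "R * B ! l \<le> 2 * (R * A ! l)"
      using mult_le_mono2[OF le(1)[OF that(1)], of R] mult_le_mono2[OF le(1)[OF that(2)], of R]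
      by (simp_all add: mult.left_commute)
    \<comment> \<open>If \<open>4 * (R * A ! m) < A ! l\<close>, then \<open>R * B ! m\<close> is at
      most \<open>2 * (R * A ! m)\<close>, less than half of \<open>A ! l\<close>, hence less than
      \<open>B ! l\<close>; symmetrically otherwise.\<close>
    then show ?thesis
      using cmp[OF that] le(2)[OF that(1)] le(2)[OF that(2)] by linarith
  qed
  show ?thesis
    using posB cmpB by (auto simp: separated_def len in_set_conv_nth)
qed

text \<open>Peeling off the first step spends one factor 4 and leaves \<open>4 ^ q * R\<close> for
  the remaining \<open>q\<close> steps.\<close>

lemma separated_relpow_pour:
  assumes "(pour ^^ q) A B" and "separated (4 ^ q * R) A" and "R > 0"
  shows "separated R B"
  using assms
proof (induction q arbitrary: A)
  case 0
  then show ?case by simp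
next
  case (Suc q)
  from Suc.prems(1) obtain C where "pour A C" "(pour ^^ q) C B"
    by (meson relpowp_Suc_D2)
  moreover have "separated (4 * (4 ^ q * R)) A"
    using Suc.prems(2) by (simp add: mult.assoc)
  ultimately show ?case
    using Suc.IH separated_pour Suc.prems(3) by simp
qed

lemma separated_mono:
  assumes "separated R A" and "S \<le> R"
  shows "separated S A"
  using assms unfolding separated_def by (meson le_less_trans mult_le_mono1)

lemma separated_not_pourable:
  assumes "separated (4 ^ p) A"
  shows "\<not> pourable p A"
proof
  assume "pourable p A"
  then obtain q B where q: "q \<le> p" "(pour ^^ q) A B" "0 \<in> set B"
    unfolding pourable_def by blast
  \<comment> \<open>The value \<open>R = 1\<close> at the end is enough, since separation includes
    positivity.\<close>
  have "separated (4 ^ q * 1) A"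
    using separated_mono[OF assms] q(1) by (simp add: power_increasing)
  then have "separated 1 B"
    using separated_relpow_pour q(2) zero_less_one by blast
  then show False
    using q(3) by (simp add: separated_def)
qed

lemma ex_separated:
  assumes "k > 0"
  shows "\<exists>b. \<forall>n>b. \<exists>A. length A = k \<and> sum_list A = n \<and> separated R A"
proof -
  obtain m where k: "k = Suc m"
    using assms gr0_conv_Suc by blast
  define P where "P = map (\<lambda>i. (R + 1) ^ i) [0..<m]"
  \<comment> \<open>The last content \<open>z\<close> makes up the prescribed sum; beyond this
    threshold it exceeds \<open>R\<close> times every power in \<open>P\<close>. The exponent
    \<open>m\<close> instead of \<open>m - 1\<close> treats \<open>m = 0\<close> uniformly.\<close>
  define b where "b = sum_list P + R * (R + 1) ^ m"
  have step: "R * (R + 1) ^ i < (R + 1) ^ j" if "i < j" for i j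
  proof -
    have "R * (R + 1) ^ i < (R + 1) ^ Suc i" by simp
    also have "\<dots> \<le> (R + 1) ^ j"
      using that by (intro power_increasing) auto
    finally show ?thesis .
  qed
  have "\<exists>A. length A = k \<and> sum_list A = n \<and> separated R A" if n: "n > b" for n
  proof -
    define z where "z = n - sum_list P"
    define A where "A = P @ [z]"
    have z: "R * (R + 1) ^ m < z"
      using n unfolding b_def z_def by linarith
    have len: "length A = k"
      by (simp add: A_def P_def k)
    have small: "A ! i = (R + 1) ^ i" if "i < m" for i
      using that by (simp add: A_def P_def nth_append)
    have last: "A ! m = z"
      by (simp add: A_def P_def nth_append)
    have lt: "R * A ! i < A ! j" if "i < j" "j < k" for i j
    proof (cases "j = m")
      case True
      have "R * (R + 1) ^ i \<le> R * (R + 1) ^ m"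
        using that True by (intro mult_le_mono2 power_increasing) auto
      also note z
      finally show ?thesis
        using True that last small by simp
    next
      case False
      then show ?thesis
        using that small step k by simp
    qed
    have "sum_list A = n"
      using n by (simp add: A_def z_def b_def)
    moreover have "separated R A"
      unfolding separated_def len
    proof (intro conjI allI impI)
      show "0 \<notin> set A"
        using z by (auto simp: A_def P_def)
      show "R * A ! i < A ! j \<or> R * A ! j < A ! i" if "i < k" "j < k" "i \<noteq> j" for i j
        using lt that by (metis nat_neq_iff)
    qed
    ultimately show ?thesis
      using len by blast
  qed
  then show ?thesis by blast
qed

lemma pourable_mono: "pourable p A \<Longrightarrow> p \<le> q \<Longrightarrow> pourable q A"
  unfolding pourable_def by (meson order_trans)

lemma pourable_if_zero_in_set: "0 \<in> set A \<Longrightarrow> pourable p A"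
  unfolding pourable_def by (intro exI[of _ 0]) auto

lemma zero_in_set_if_sum_list_less_length:
  fixes A :: "nat list"
  assumes "sum_list A < length A"
  shows "0 \<in> set A"
  using assms by (induction A) force+

theorem theorem28:
  fixes N k :: nat
  assumes "N > 0" and "k \<ge> 3"
  shows "h N k \<le> h (N + 1) k"
proof -
  define P where
    "P p n \<longleftrightarrow> n > 0 \<and> (\<forall>A. length A = k \<and> sum_list A = n \<longrightarrow> pourable p A)" for p n
  have h: "h p k = (GREATEST n. P p n)" for p
    by (simp add: h_def P_def)
  have "\<exists>b. \<forall>n. P p n \<longrightarrow> n \<le> b" for p
  proof -
    obtain b where b: "\<And>n. n > b \<Longrightarrow> \<exists>A. length A = k \<and> sum_list A = n \<and> separated (4 ^ p) A"
      using ex_separated[of k "4 ^ p"] assms(2) by auto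
    have "n \<le> b" if "P p n" for n
      using b[of n] that separated_not_pourable unfolding P_def by (meson not_le)
    then show ?thesis by blast
  qed
  then obtain b where b: "\<And>p n. P p n \<Longrightarrow> n \<le> b p"
    by metis
  \<comment> \<open>Sum 1 spread over at least three vessels leaves one empty, so the maximum is
    taken over a nonempty set.\<close>
  have "P N 1"
    using assms(2) by (auto simp: P_def intro!: pourable_if_zero_in_set zero_in_set_if_sum_list_less_length)
  then have "P N (h N k)"
    unfolding h using b by (rule GreatestI_nat)
  then have "P (N + 1) (h N k)"
    unfolding P_def using pourable_mono le_add1 by blast
  then show ?thesis
    unfolding h[of "N + 1"] using b by (rule Greatest_le_nat)
qed

end
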